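(* Let $\mathcal{A}$ be a unital associative algebra over $\mathbb{Q}$, $\mathcal{C}\subseteq\mathcal{A}$ a commutative subalgebra, $\mathcal{I}$ the Lie idealiser of $\mathcal{C}$ in $\mathcal{A}$, and $d\in\mathcal{I}\setminus\mathcal{C}$. Then $\mathfrak{F}$ is a Lie algebra (under the commutator) where commutators can be solved explicitly using the rule $$[\langle x\rangle_k,\langle y\rangle_l]=\sum_{n=0}^{\frac{k+l-1}{2}}\ \sum_{i=0}^{2n+1}\lambda_{n,i}^{k,l}\,\bigl\langle (D^i x)(D^{2n+1-i}y)\bigr\rangle_{k+l-2n-1}\qquad (x,y\in\mathcal{C},\ k,l\ge 0),$$ where $\lambda_{n,i}^{k,l}=2\pi_{2n+1,i}^{k,l}\in\mathbb{Q}$ (the outer sum runs over the integers $n$ with $0\le n\le\frac{k+l-1}{2}$).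
   Context: The commutator is $[a,b]=a\cdot b-b\cdot a$. The Lie idealiser of $\mathcal{C}$ in $\mathcal{A}$ is $\mathcal{I}=\{d\in\mathcal{A}: [d,\mathcal{C}]\subseteq\mathcal{C}\}$. For the fixed $d\in\mathcal{I}\setminus\mathcal{C}$, $D=\mathrm{ad}_d$, $D(a)=[d,a]$, which maps $\mathcal{C}$ to $\mathcal{C}$; $D^0=\mathrm{id}$. For $x\in\mathcal{C}$ and an integer $k\ge 0$, $\langle x\rangle_k=\tfrac12(x\cdot d^k+d^k\cdot x)$, with $d^0=1_{\mathcal{A}}$. For each $k\ge 0$, $\mathfrak{F}_k$ is the linear space $\{\langle x\rangle_k: x\in\mathcal{C}\}$, and $\mathfrak{F}=\bigoplus_{k\ge 0}\mathfrak{F}_k$ denotes the direct sum of these linear spaces. The rational numbers $\pi_{a,p}^{k,l}$ ($k,l\ge 0$, $0\le p\le a\le k+l$) are the coefficients in the product formula $\langle x\rangle_k\cdot\langle y\rangle_l=\sum_{n=0}^{k+l}\sum_{i=0}^{n}\pi_{n,i}^{k,l}\langle (D^i x)(D^{n-i}y)\rangle_{k+l-n}$ that are given recursively, starting from $\pi_{0,0}^{k,l}=1$, by $$\pi_{a,p}^{k,l}=\frac14\left(L_{a,p}^{k,l}-2\sum_{n=0}^{a-1}\binom{k+l-n}{a-n}\sum_{i=0}^{n}\pi_{n,i}^{k,l}\binom{a-n}{p-i}\right),$$ $$L_{a,p}^{k,l}=\delta_{p,0}\left(\binom{k}{a}+\binom{k+l}{a}\right)+\binom{k}{p}\left(\binom{k-p}{a-p}+\binom{k+l-p}{a-p}\right),$$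 where $\delta$ is the Kronecker delta, $\binom{m}{r}=0$ if $r<0$ or $r>m\ge 0$, and a product with the factor $\binom{k}{p}=0$ ($p>k$) is $0$.
   Formalization: 𝔉 is taken as the sum of the subspaces F_k inside 𝒜, with the commutator of 𝒜, and directness is not asserted: the sum need not be direct (𝒜=M₂(ℚ), 𝒞=ℚe₁₂, d=e₁₁), and on the external direct sum the rule need not define a bracket. *)

theory Defs
  imports Complex_Main
begin

text \<open>
  Unital associative algebras over the rationals. The class \<^class>\<open>ring_1\<close> excludes only the
  zero algebra, which has no element outside a subalgebra.
\<close>

locale rat_algebra = vector_space scale
  for scale :: "rat \<Rightarrow> 'a::ring_1 \<Rightarrow> 'a" +
  assumes scale_mult_left: "scale r x * y = scale r (x * y)"
    and scale_mult_right: "x * scale r y = scale r (x * y)"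

text \<open>A commutative subalgebra is not required to contain the unit of the ambient algebra.\<close>

definition commutative_subalgebra :: "(rat \<Rightarrow> 'a::ring_1 \<Rightarrow> 'a) \<Rightarrow> 'a set \<Rightarrow> bool" where
  "commutative_subalgebra scale C \<longleftrightarrow>
     module.subspace scale C \<and>
     (\<forall>x\<in>C. \<forall>y\<in>C. x * y \<in> C) \<and>
     (\<forall>x\<in>C. \<forall>y\<in>C. x * y = y * x)"

definition commutator :: "'a::ring \<Rightarrow> 'a \<Rightarrow> 'a" where
  "commutator a b = a * b - b * a"

definition lie_idealiser :: "'a::ring set \<Rightarrow> 'a set" where
  "lie_idealiser C = {d. \<forall>c\<in>C. commutator d c \<in> C}"

text \<open>A Lie algebra whose underlying vector space is a subspace \<open>L\<close> of an ambient space.\<close>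

locale lie_algebra_on = vector_space scale
  for scale :: "'k::field \<Rightarrow> 'v::ab_group_add \<Rightarrow> 'v"
    and L :: "'v set"
    and br :: "'v \<Rightarrow> 'v \<Rightarrow> 'v" +
  assumes carrier_subspace: "subspace L"
    and br_closed: "\<lbrakk>x \<in> L; y \<in> L\<rbrakk> \<Longrightarrow> br x y \<in> L"
    and br_add_left: "\<lbrakk>x \<in> L; y \<in> L; z \<in> L\<rbrakk> \<Longrightarrow> br (x + y) z = br x z + br y z"
    and br_add_right: "\<lbrakk>x \<in> L; y \<in> L; z \<in> L\<rbrakk> \<Longrightarrow> br x (y + z) = br x y + br x z"
    and br_scale_left: "\<lbrakk>x \<in> L; y \<in> L\<rbrakk> \<Longrightarrow> br (scale r x) y = scale r (br x y)"
    and br_scale_right: "\<lbrakk>x \<in> L; y \<in> L\<rbrakk> \<Longrightarrow> br x (scale r y) = scale r (br x y)"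
    and br_alternating: "x \<in> L \<Longrightarrow> br x x = 0"
    and br_jacobi: "\<lbrakk>x \<in> L; y \<in> L; z \<in> L\<rbrakk> \<Longrightarrow>
      br x (br y z) + br y (br z x) + br z (br x y) = 0"

text \<open>\<open>sym_elem scale d x k\<close> is $\langle x\rangle_k = \frac12 (x d^k + d^k x)$.\<close>

definition sym_elem :: "(rat \<Rightarrow> 'a::ring_1 \<Rightarrow> 'a) \<Rightarrow> 'a \<Rightarrow> 'a \<Rightarrow> nat \<Rightarrow> 'a" where
  "sym_elem scale d x k = scale (1/2) (x * d ^ k + d ^ k * x)"

definition F_comp :: "(rat \<Rightarrow> 'a::ring_1 \<Rightarrow> 'a) \<Rightarrow> 'a set \<Rightarrow> 'a \<Rightarrow> nat \<Rightarrow> 'a set" where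
  "F_comp scale C d k = {sym_elem scale d x k | x. x \<in> C}"

text \<open>
  The sum of the spaces \<open>F_comp scale C d k\<close> is taken inside the algebra, where the commutator
  lives. It need not be direct: for \<open>d\<close> a matrix unit $e_{11}$ and \<open>C\<close> spanned by $e_{12}$, all the
  components coincide.
\<close>

definition F_sum :: "(rat \<Rightarrow> 'a::ring_1 \<Rightarrow> 'a) \<Rightarrow> 'a set \<Rightarrow> 'a \<Rightarrow> 'a set" where
  "F_sum scale C d =
     {\<Sum>k\<in>K. f k | K f. finite K \<and> (\<forall>k\<in>K. f k \<in> F_comp scale C d k)}"

text \<open>
  Binomial coefficients that vanish outside $0 \leq r \leq m$. Integer arguments avoid truncated
  subtraction in the recursion below.
\<close>

definition binom :: "int \<Rightarrow> int \<Rightarrow> rat" where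
  "binom m r = (if 0 \<le> r \<and> r \<le> m then of_nat (nat m choose nat r) else 0)"

text \<open>The case $a = p = 0$ of the recursion gives the initial value 1.\<close>

fun pi_coeff :: "nat \<Rightarrow> nat \<Rightarrow> nat \<Rightarrow> nat \<Rightarrow> rat" where
  "pi_coeff k l a p =
     1/4 * (((if p = 0 then 1 else 0) * (binom (int k) (int a) + binom (int k + int l) (int a))
             + binom (int k) (int p) *
               (binom (int k - int p) (int a - int p)
                + binom (int k + int l - int p) (int a - int p)))
            - 2 * (\<Sum>n<a. binom (int k + int l - int n) (int a - int n) *
                 (\<Sum>i\<le>n. pi_coeff k l n i * binom (int a - int n) (int p - int i))))"

declare pi_coeff.simps [simp del]

lemma pi_coeff_0_0: "pi_coeff k l 0 0 = 1"
  by (subst pi_coeff.simps) (simp add: binom_def)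

definition lambda_coeff :: "nat \<Rightarrow> nat \<Rightarrow> nat \<Rightarrow> nat \<Rightarrow> rat" where
  "lambda_coeff k l n i = 2 * pi_coeff k l (2 * n + 1) i"

end

theory Submission
  imports Defs "HOL-Computational_Algebra.Polynomial"
begin

text \<open>
  Moving every $d$ to the right, with $u$ and $v$ recording the action of $D$ on $x$ and $y$, turns
  the recursion for the $\pi_{n,i}^{k,l}$ into the functional equation
  $2 f(e) + 2 f(e + u + v) = (e+v)^k e^l + (e+v)^{k+l} + (e+u+v)^k e^l + (e+u+v)^k (e+v)^l$
  for $f(e) = \sum_{n,i} \pi_{n,i}^{k,l} u^i v^{n-i} e^{k+l-n}$, whose polynomial solution is unique.
  Substituting $-u$, $-v$ and $e + u + v$ exchanges the roles of $(k, u)$ and $(l, v)$ on the right,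
  so $\pi_{n,n-i}^{l,k} = (-1)^n \pi_{n,i}^{k,l}$. In the commutator the terms with even $n$ therefore
  cancel and those with odd $n$ double.
\<close>

section \<open>The recursion for the coefficients as a summation identity\<close>

lemma binom_diff:
  assumes "n \<le> a" "a \<le> m"
  shows "binom (int m - int n) (int a - int n) = of_nat ((m - n) choose (a - n))"
  using assms by (simp add: binom_def flip: of_nat_diff)

lemma binom_of_nat: "binom (int m) (int r) = of_nat (m choose r)"
  by (auto simp: binom_def binomial_eq_0)

text \<open>Two of the four copies of \<open>pi_coeff k l a p\<close> in the recursion supply the
  missing term \<open>n = a\<close> of the sum; the other two stay in front. In the range
  \<open>a \<le> k + l\<close>, \<open>p \<le> a\<close> the integer binomials can be replaced by
  those on the naturals.\<close>

lemma pi_coeff_rec: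
  assumes "a \<le> k + l" "p \<le> a"
  shows "2 * pi_coeff k l a p
      + 2 * (\<Sum>n\<le>a. of_nat ((k + l - n) choose (a - n)) *
              (\<Sum>i\<le>n. pi_coeff k l n i * binom (int a - int n) (int p - int i)))
    = (if p = 0 then of_nat (k choose a) + of_nat ((k + l) choose a) else 0)
      + of_nat (k choose p) * (of_nat ((k - p) choose (a - p)) + of_nat ((k + l - p) choose (a - p)))"
proof -
  \<comment> \<open>For \<open>n = a\<close> the upper entry of \<open>binom\<close> is 0, so it is
    the Kronecker delta of \<open>i\<close> and \<open>p\<close>.\<close>
  have top: "(\<Sum>i\<le>a. pi_coeff k l a i * binom (int a - int a) (int p - int i)) = pi_coeff k l a p"
  proof -
    have "(\<Sum>i\<le>a. pi_coeff k l a i * binom (int a - int a) (int p - int i))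
        = (\<Sum>i\<le>a. if i = p then pi_coeff k l a i else 0)"
      by (intro sum.cong) (auto simp: binom_def)
    then show ?thesis using assms by simp
  qed
  have lower: "(\<Sum>n<a. binom (int k + int l - int n) (int a - int n) *
        (\<Sum>i\<le>n. pi_coeff k l n i * binom (int a - int n) (int p - int i)))
      = (\<Sum>n<a. of_nat ((k + l - n) choose (a - n)) *
        (\<Sum>i\<le>n. pi_coeff k l n i * binom (int a - int n) (int p - int i)))"
    using assms binom_diff[of _ a "k + l"] by (intro sum.cong) auto
  have L: "binom (int k) (int p) *
        (binom (int k - int p) (int a - int p) + binom (int k + int l - int p) (int a - int p))
      = of_nat (k choose p) * (of_nat ((k - p) choose (a - p)) + of_nat ((k + l - p) choose (a - p)))"
  \<comment> \<open>For \<open>p > k\<close> the truncated difference \<open>k - p\<close> does no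
    harm, since the factor \<open>k choose p\<close> vanishes.\<close>
  proof (cases "p \<le> k")
    case True
    then have "binom (int k - int p) (int a - int p) = of_nat ((k - p) choose (a - p))"
      using assms binom_of_nat[of "k - p" "a - p"] by (simp add: of_nat_diff)
    then show ?thesis
      using assms binom_diff[of p a "k + l"] by (simp add: binom_of_nat)
  qed (simp add: binom_of_nat binomial_eq_0)
  have "(\<Sum>n\<le>a. of_nat ((k + l - n) choose (a - n)) *
          (\<Sum>i\<le>n. pi_coeff k l n i * binom (int a - int n) (int p - int i)))
     = (\<Sum>n<a. of_nat ((k + l - n) choose (a - n)) *
          (\<Sum>i\<le>n. pi_coeff k l n i * binom (int a - int n) (int p - int i)))
       + pi_coeff k l a p"
    using top by (simp add: lessThan_Suc_atMost[symmetric])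
  moreover have "4 * pi_coeff k l a p =
      (if p = 0 then of_nat (k choose a) + of_nat ((k + l) choose a) else 0)
      + of_nat (k choose p) * (of_nat ((k - p) choose (a - p)) + of_nat ((k + l - p) choose (a - p)))
      - 2 * (\<Sum>n<a. of_nat ((k + l - n) choose (a - n)) *
          (\<Sum>i\<le>n. pi_coeff k l n i * binom (int a - int n) (int p - int i)))"
    by (subst pi_coeff.simps)
      (simp only: L lower, simp add: binom_of_nat flip: of_nat_add)
  ultimately show ?thesis by simp
qed

lemma sum_atMost_nested_swap:
  fixes g :: "nat \<Rightarrow> nat \<Rightarrow> 'b::comm_monoid_add"
  shows "(\<Sum>a\<le>m. \<Sum>n\<le>a. g a n) = (\<Sum>n\<le>m. \<Sum>j\<le>m - n. g (n + j) n)"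
  by (simp add: sum.Sigma, rule sum.reindex_bij_witness[where i="\<lambda>(n, j). (n + j, n)" and j="\<lambda>(a, n). (n, a - n)"])
    auto

text \<open>The left-hand coefficient vanishes outside \<open>i \<le> p \<le> i + N\<close>, and
  this interval lies inside the range of summation. The substitution \<open>p = i + q\<close> thus
  trades the integer \<open>binom\<close> of the recursion for an ordinary binomial
  coefficient.\<close>

lemma sum_binom_shift:
  assumes "vector_space s" and "i + N \<le> a"
  shows "(\<Sum>p\<le>a. s (c * binom (int N) (int p - int i)) (S p))
       = (\<Sum>q\<le>N. s (c * of_nat (N choose q)) (S (i + q)))"
proof -
  interpret vector_space s by fact
  have "(\<Sum>q\<le>N. s (c * of_nat (N choose q)) (S (i + q)))
      = (\<Sum>p\<in>{i..i + N}. s (c * binom (int N) (int p - int i)) (S p))"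
    by (rule sum.reindex_bij_witness[where j="\<lambda>q. i + q" and i="\<lambda>p. p - i"])
      (auto simp: binom_of_nat)
  also have "\<dots> = (\<Sum>p\<le>a. s (c * binom (int N) (int p - int i)) (S p))"
    using assms(2) by (intro sum.mono_neutral_left) (auto simp: binom_def)
  finally show ?thesis by simp
qed

lemma sum_binomial_extend:
  assumes "vector_space s" and "N \<le> (M::nat)"
  shows "(\<Sum>q\<le>M. s (c * of_nat (N choose q)) (S q)) = (\<Sum>q\<le>N. s (c * of_nat (N choose q)) (S q))"
proof -
  interpret vector_space s by fact
  show ?thesis
    using assms(2) by (intro sum.mono_neutral_right) (auto simp: binomial_eq_0)
qed

text \<open>
  \<open>T i j r\<close> stands for the monomial $D^i x \cdot D^j y \cdot d^r$. Keeping it abstract lets the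
  identity be read both in the algebra and for commuting rational variables.
\<close>

lemma pi_coeff_expansion:
  fixes s :: "rat \<Rightarrow> 'b::ab_group_add \<Rightarrow> 'b" and T :: "nat \<Rightarrow> nat \<Rightarrow> nat \<Rightarrow> 'b"
  assumes "vector_space s"
  shows "(\<Sum>n\<le>k + l. \<Sum>i\<le>n. s (2 * pi_coeff k l n i) (T i (n - i) (k + l - n)
           + (\<Sum>j\<le>k + l - n. \<Sum>q\<le>j. s (of_nat ((k + l - n) choose j) * of_nat (j choose q))
                (T (i + q) (n - i + (j - q)) (k + l - n - j)))))
     = (\<Sum>j\<le>k. s (of_nat (k choose j)) (T 0 j (k + l - j)))
     + (\<Sum>j\<le>k + l. s (of_nat ((k + l) choose j)) (T 0 j (k + l - j)))
     + (\<Sum>p\<le>k. \<Sum>q\<le>k - p. s (of_nat (k choose p) * of_nat ((k - p) choose q)) (T p q (k + l - p - q)))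
     + (\<Sum>p\<le>k. \<Sum>q\<le>k + l - p.
          s (of_nat (k choose p) * of_nat ((k + l - p) choose q)) (T p q (k + l - p - q)))"
proof -
  interpret vector_space s by fact
  define m where "m = k + l"
  have km: "k \<le> m" by (simp add: m_def)
  \<comment> \<open>The monomial with \<open>a\<close> applications of \<open>D\<close> in total,
    \<open>p\<close> of them on \<open>x\<close>.\<close>
  let ?T = "\<lambda>a p. T p (a - p) (m - a)"
  let ?pi = "pi_coeff k l"
  let ?inner = "\<lambda>a p. \<Sum>n\<le>a. of_nat ((m - n) choose (a - n)) *
              (\<Sum>i\<le>n. ?pi n i * binom (int a - int n) (int p - int i))"
  let ?L = "\<lambda>a p. (if p = 0 then of_nat (k choose a) + of_nat (m choose a) else 0)
      + of_nat (k choose p) * (of_nat ((k - p) choose (a - p)) + of_nat ((m - p) choose (a - p)))"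
  \<comment> \<open>The recursion is weighted with \<open>?T a p\<close> and summed over the
    triangle \<open>p \<le> a \<le> m\<close>; the remaining steps bring each piece into the stated
    form.\<close>
  have "(\<Sum>a\<le>m. \<Sum>p\<le>a. s (2 * ?pi a p + 2 * ?inner a p) (?T a p)) = (\<Sum>a\<le>m. \<Sum>p\<le>a. s (?L a p) (?T a p))"
    by (intro sum.cong refl arg_cong[where f="\<lambda>c. s c _"]) (use pi_coeff_rec in \<open>simp add: m_def\<close>)
  \<comment> \<open>Collecting by the coefficient \<open>?pi n i\<close> uses
    \<open>a = n + j\<close> and \<open>p = i + q\<close>.\<close>
  moreover have "(\<Sum>a\<le>m. \<Sum>p\<le>a. s (2 * ?inner a p) (?T a p))
      = (\<Sum>n\<le>m. \<Sum>i\<le>n. s (2 * ?pi n i) (\<Sum>j\<le>m - n. \<Sum>q\<le>j. s (of_nat ((m - n) choose j) * of_nat (j choose q))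
                (T (i + q) (n - i + (j - q)) (m - n - j))))"
  proof -
    have "(\<Sum>a\<le>m. \<Sum>p\<le>a. s (2 * ?inner a p) (?T a p))
        = (\<Sum>a\<le>m. \<Sum>n\<le>a. \<Sum>i\<le>n. \<Sum>p\<le>a.
            s (2 * ?pi n i * of_nat ((m - n) choose (a - n)) * binom (int a - int n) (int p - int i)) (?T a p))"
      unfolding sum_distrib_left scale_sum_left
      by (rule sum.cong[OF refl], subst sum.swap, rule sum.cong[OF refl], subst sum.swap)
        (simp add: mult_ac)
    also have "\<dots> = (\<Sum>n\<le>m. \<Sum>j\<le>m - n. \<Sum>i\<le>n. \<Sum>p\<le>n + j.
            s (2 * ?pi n i * of_nat ((m - n) choose j) * binom (int j) (int p - int i)) (?T (n + j) p))"
      by (subst sum_atMost_nested_swap) simp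
    also have "\<dots> = (\<Sum>n\<le>m. \<Sum>j\<le>m - n. \<Sum>i\<le>n. \<Sum>q\<le>j.
            s (2 * ?pi n i * of_nat ((m - n) choose j) * of_nat (j choose q)) (?T (n + j) (i + q)))"
      by (intro sum.cong refl sum_binom_shift assms) auto
    also have "\<dots> = (\<Sum>n\<le>m. \<Sum>i\<le>n. \<Sum>j\<le>m - n. \<Sum>q\<le>j.
            s (2 * ?pi n i * of_nat ((m - n) choose j) * of_nat (j choose q)) (?T (n + j) (i + q)))"
      by (intro sum.cong refl sum.swap)
    also have "\<dots> = (\<Sum>n\<le>m. \<Sum>i\<le>n. s (2 * ?pi n i) (\<Sum>j\<le>m - n. \<Sum>q\<le>j. s (of_nat ((m - n) choose j) * of_nat (j choose q))
                (T (i + q) (n - i + (j - q)) (m - n - j))))"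
      unfolding scale_sum_right
      by (intro sum.cong refl) (auto simp: mult_ac intro!: arg_cong2[where f=s] arg_cong2[where f="T _"])
    finally show ?thesis .
  qed
  \<comment> \<open>This and the next identity are needed for \<open>K = k\<close> and
    \<open>K = m\<close>, which together give the four sums on the right.\<close>
  moreover have "(\<Sum>a\<le>m. \<Sum>p\<le>a. s (if p = 0 then of_nat (K choose a) else 0) (?T a p))
      = (\<Sum>j\<le>K. s (of_nat (K choose j)) (T 0 j (m - j)))" if "K \<le> m" for K
  proof -
    have "(\<Sum>p\<le>a. s (if p = 0 then of_nat (K choose a) else 0) (?T a p)) =
        s (1 * of_nat (K choose a)) (T 0 a (m - a))" for a
      by (subst sum.atMost_shift) simp
    then show ?thesis
      using sum_binomial_extend[OF assms that, where c=1 and S="\<lambda>j. T 0 j (m - j)"] by simp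
  qed
  moreover have "(\<Sum>a\<le>m. \<Sum>p\<le>a. s (of_nat (k choose p) * of_nat ((K - p) choose (a - p))) (?T a p))
      = (\<Sum>p\<le>k. \<Sum>q\<le>K - p. s (of_nat (k choose p) * of_nat ((K - p) choose q)) (T p q (m - p - q)))"
    if "k \<le> K" "K \<le> m" for K
  proof -
    have "(\<Sum>a\<le>m. \<Sum>p\<le>a. s (of_nat (k choose p) * of_nat ((K - p) choose (a - p))) (?T a p))
        = (\<Sum>p\<le>m. \<Sum>q\<le>m - p. s (of_nat (k choose p) * of_nat ((K - p) choose q)) (T p q (m - p - q)))"
      by (subst sum_atMost_nested_swap) simp
    also have "\<dots> = (\<Sum>p\<le>k. \<Sum>q\<le>m - p. s (of_nat (k choose p) * of_nat ((K - p) choose q)) (T p q (m - p - q)))"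
      using km by (intro sum.mono_neutral_right) (auto simp: binomial_eq_0)
    also have "\<dots> = (\<Sum>p\<le>k. \<Sum>q\<le>K - p. s (of_nat (k choose p) * of_nat ((K - p) choose q)) (T p q (m - p - q)))"
      using that by (intro sum.cong refl sum_binomial_extend assms) auto
    finally show ?thesis .
  qed
  moreover have "(\<Sum>a\<le>m. \<Sum>p\<le>a. s (?L a p) (?T a p))
      = (\<Sum>a\<le>m. \<Sum>p\<le>a. s (if p = 0 then of_nat (k choose a) else 0) (?T a p))
      + (\<Sum>a\<le>m. \<Sum>p\<le>a. s (if p = 0 then of_nat (m choose a) else 0) (?T a p))
      + (\<Sum>a\<le>m. \<Sum>p\<le>a. s (of_nat (k choose p) * of_nat ((k - p) choose (a - p))) (?T a p))
      + (\<Sum>a\<le>m. \<Sum>p\<le>a. s (of_nat (k choose p) * of_nat ((m - p) choose (a - p))) (?T a p))"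
    unfolding sum.distrib[symmetric]
    by (intro sum.cong refl) (simp add: scale_left_distrib distrib_left)
  ultimately show ?thesis
    using km unfolding m_def[symmetric] scale_left_distrib scale_right_distrib sum.distrib by simp
qed

section \<open>Functional equation and reflection symmetry of the coefficients\<close>

text \<open>This is \<open>pi_coeff_expansion\<close> read with \<open>T i j r\<close> as the
  monomial \<open>u ^ i * v ^ j * e ^ r\<close>: the inner double sum is then a trinomial expansion,
  which produces the value at the shifted point \<open>e + (u + v)\<close>.\<close>

lemma sum_pi_coeff_powers:
  fixes e u v :: rat
  shows "2 * ((\<Sum>n\<le>k + l. \<Sum>i\<le>n. pi_coeff k l n i * (u ^ i * v ^ (n - i)) * e ^ (k + l - n))
           + (\<Sum>n\<le>k + l. \<Sum>i\<le>n. pi_coeff k l n i * (u ^ i * v ^ (n - i)) * (e + (u + v)) ^ (k + l - n)))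
     = (e + v) ^ k * e ^ l + (e + v) ^ (k + l) + (e + (u + v)) ^ k * e ^ l
       + (e + (u + v)) ^ k * (e + v) ^ l"
proof -
  have binomial': "(e + x) ^ K = (\<Sum>j\<le>K. of_nat (K choose j) * x ^ j * e ^ (K - j))" for x e :: rat and K
    using binomial_ring[of x e K] by (simp add: add.commute)
  \<comment> \<open>The sum over \<open>j\<close> expands \<open>e + (u + v)\<close>, the one over
    \<open>q\<close> then expands \<open>u + v\<close>.\<close>
  have inner: "(\<Sum>j\<le>M. \<Sum>q\<le>j. (of_nat (M choose j) * of_nat (j choose q)) *
        (u ^ (i + q) * v ^ (r + (j - q)) * e ^ (M - j)))
      = u ^ i * v ^ r * (e + (u + v)) ^ M" for M i r
    unfolding binomial'[of e "u + v" M] sum_distrib_left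
    by (intro sum.cong refl)
      (simp add: binomial_ring sum_distrib_left sum_distrib_right power_add mult_ac
        del: Nat.add_diff_assoc Nat.add_diff_assoc2)
  have q_sum: "(\<Sum>q\<le>K. (c * of_nat (K choose q)) * (z * v ^ q * e ^ (K + r - q)))
      = c * (z * ((e + v) ^ K * e ^ r))" for c z K r
    unfolding binomial' sum_distrib_left sum_distrib_right
    by (intro sum.cong refl) (simp add: power_add mult_ac Nat.diff_add_assoc2 del: Nat.add_diff_assoc2)
  have p_sum: "(\<Sum>p\<le>k. of_nat (k choose p) * (u ^ p * (e + v) ^ (k - p))) = (e + (u + v)) ^ k"
    using binomial'[of "e + v" u k] by (simp add: ac_simps)
  have 3: "(\<Sum>p\<le>k. \<Sum>q\<le>k - p. (of_nat (k choose p) * of_nat ((k - p) choose q)) *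
        (u ^ p * v ^ q * e ^ (k + l - p - q))) = (e + (u + v)) ^ k * e ^ l"
    unfolding p_sum[symmetric] sum_distrib_right
  proof (intro sum.cong refl)
    fix p assume "p \<in> {..k}"
    then have "k + l - p - q = k - p + l - q" for q by simp
    then show "(\<Sum>q\<le>k - p. (of_nat (k choose p) * of_nat ((k - p) choose q)) * (u ^ p * v ^ q * e ^ (k + l - p - q)))
        = of_nat (k choose p) * (u ^ p * (e + v) ^ (k - p)) * e ^ l"
      by (simp only: q_sum)
  qed
  have 4: "(\<Sum>p\<le>k. \<Sum>q\<le>k + l - p. (of_nat (k choose p) * of_nat ((k + l - p) choose q)) *
        (u ^ p * v ^ q * e ^ (k + l - p - q))) = (e + (u + v)) ^ k * (e + v) ^ l"
    unfolding p_sum[symmetric] sum_distrib_right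
  proof (intro sum.cong refl)
    fix p assume "p \<in> {..k}"
    then have "(e + v) ^ (k + l - p) = (e + v) ^ (k - p) * (e + v) ^ l"
      by (simp flip: power_add)
    then show "(\<Sum>q\<le>k + l - p. (of_nat (k choose p) * of_nat ((k + l - p) choose q)) * (u ^ p * v ^ q * e ^ (k + l - p - q)))
        = of_nat (k choose p) * (u ^ p * (e + v) ^ (k - p)) * (e + v) ^ l"
      using q_sum[where K="k + l - p" and r=0 and c="of_nat (k choose p)" and z="u ^ p"]
      by (simp add: mult_ac)
  qed
  have "vector_space ((*) :: rat \<Rightarrow> rat \<Rightarrow> rat)"
    by unfold_locales (simp_all add: algebra_simps)
  then show ?thesis
    using pi_coeff_expansion[of "(*)"
        k l "\<lambda>i j r. u ^ i * v ^ j * e ^ r"]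
    unfolding inner 3 4
    using q_sum[where K=k and r=l and c=1 and z=1] q_sum[where K="k + l" and r=0 and c=1 and z=1]
    by (simp add: distrib_left sum.distrib sum_distrib_left mult_ac)
qed

text \<open>A polynomial and its translate have the same leading coefficient, so adding them doubles
  it. The sum can vanish only if the polynomial does; this is applied to the difference
  \<open>p - q\<close>.\<close>

lemma poly_eq_if_shift_sum_eq:
  fixes p q :: "rat poly"
  assumes "\<And>e. poly p e + poly p (e + w) = poly q e + poly q (e + w)"
  shows "p = q"
proof -
  define r where "r = p - q"
  have "r + pcompose r [:w, 1:] = 0"
    by (rule poly_eq_poly_eq_iff[THEN iffD1], rule ext)
      (use assms in \<open>simp add: r_def poly_pcompose algebra_simps\<close>)
  then have "lead_coeff (pcompose r [:w, 1:]) = - lead_coeff r"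
    by (simp add: add_eq_0_iff)
  then have "lead_coeff r = 0"
    by (simp add: lead_coeff_comp)
  then have "r = 0" by (simp only: leading_coeff_0_iff)
  then show ?thesis by (simp add: r_def)
qed

text \<open>Homogeneity permits setting \<open>v = 1\<close>: the exponent of \<open>e\<close> still
  determines \<open>n\<close> and that of \<open>u\<close> determines \<open>i\<close>. Coefficients
  are compared first as polynomials in \<open>e\<close> (by \<open>A\<close>), then as polynomials
  in \<open>u\<close> (by \<open>B\<close>).\<close>

lemma rat_homogeneous_coeffs_eqI:
  fixes a b :: "nat \<Rightarrow> nat \<Rightarrow> rat"
  assumes "\<And>e u v. (\<Sum>n\<le>m. \<Sum>i\<le>n. a n i * (u ^ i * v ^ (n - i)) * e ^ (m - n))
                   = (\<Sum>n\<le>m. \<Sum>i\<le>n. b n i * (u ^ i * v ^ (n - i)) * e ^ (m - n))"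
    and "n \<le> m" "i \<le> n"
  shows "a n i = b n i"
proof -
  define A where "A c u = (\<Sum>n\<le>m. monom (\<Sum>i\<le>n. c n i * u ^ i) (m - n))"
    for c :: "nat \<Rightarrow> nat \<Rightarrow> rat" and u
  define B where "B c = (\<Sum>i\<le>n. monom (c n i) i)" for c :: "nat \<Rightarrow> nat \<Rightarrow> rat"
  have coeff_A: "coeff (A c u) (m - n) = poly (B c) u" for c u
  proof -
    have "coeff (A c u) (m - n) = (\<Sum>j\<le>m. if j = n then \<Sum>i\<le>j. c j i * u ^ i else 0)"
      unfolding A_def coeff_sum coeff_monom using \<open>n \<le> m\<close> by (intro sum.cong) auto
    then show ?thesis
      using \<open>n \<le> m\<close> by (simp add: B_def poly_sum poly_monom)
  qed
  have coeff_B: "coeff (B c) i = c n i" for c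
    using \<open>i \<le> n\<close> by (simp add: B_def coeff_sum)
  have "A a u = A b u" for u
    using assms(1)[of u 1]
    by (intro poly_eq_poly_eq_iff[THEN iffD1] ext)
      (simp add: A_def poly_sum poly_monom sum_distrib_right)
  then have "poly (B a) u = poly (B b) u" for u
    by (metis coeff_A)
  then have "B a = B b"
    by (intro poly_eq_poly_eq_iff[THEN iffD1] ext)
  then show ?thesis by (metis coeff_B)
qed

lemma pi_coeff_swap:
  assumes "n \<le> k + l" "i \<le> n"
  shows "pi_coeff l k n (n - i) = (-1) ^ n * pi_coeff k l n i"
proof -
  let ?b = "\<lambda>n i. (-1) ^ n * pi_coeff k l n i"
  define P where "P c u v = (\<Sum>n\<le>k + l. \<Sum>i\<le>n. monom (c n i * (u ^ i * v ^ (n - i))) (k + l - n))"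
    for c :: "nat \<Rightarrow> nat \<Rightarrow> rat" and u v :: rat
  have poly_P: "poly (P c u v) e = (\<Sum>n\<le>k + l. \<Sum>i\<le>n. c n i * (u ^ i * v ^ (n - i)) * e ^ (k + l - n))"
    for c u v e
    by (simp add: P_def poly_sum poly_monom)
  \<comment> \<open>Reversing \<open>i\<close> to \<open>n - i\<close> amounts to exchanging
    \<open>u\<close> and \<open>v\<close>.\<close>
  have flip: "poly (P (\<lambda>n i. pi_coeff l k n (n - i)) u v) e = poly (P (pi_coeff l k) v u) e" for u v e
    unfolding poly_P add.commute[of l k]
  proof (rule sum.cong[OF refl])
    fix n assume "n \<in> {..k + l}"
    show "(\<Sum>i\<le>n. pi_coeff l k n (n - i) * (u ^ i * v ^ (n - i)) * e ^ (k + l - n))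
        = (\<Sum>i\<le>n. pi_coeff l k n i * (v ^ i * u ^ (n - i)) * e ^ (k + l - n))"
      by (rule sum.reindex_bij_witness[where i="\<lambda>i. n - i" and j="\<lambda>i. n - i"])
        (auto simp: ac_simps)
  qed
  have neg: "poly (P ?b u v) e = poly (P (pi_coeff k l) (- u) (- v)) e" for u v e
  proof -
    have "(- u) ^ i * (- v) ^ (n - i) = (-1) ^ n * (u ^ i * v ^ (n - i))" if "i \<le> n" for i n
    proof -
      have "(-1) ^ n = (-1) ^ i * (-1 :: rat) ^ (n - i)"
        using that by (simp flip: power_add)
      then show ?thesis by (simp add: power_minus[of u] power_minus[of v] mult_ac)
    qed
    then show ?thesis unfolding poly_P by (intro sum.cong refl) (simp add: mult_ac)
  qed
  have "P (\<lambda>n i. pi_coeff l k n (n - i)) u v = P ?b u v" for u v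
  proof (rule poly_eq_if_shift_sum_eq[where w = "u + v"])
    fix e
    show "poly (P (\<lambda>n i. pi_coeff l k n (n - i)) u v) e
        + poly (P (\<lambda>n i. pi_coeff l k n (n - i)) u v) (e + (u + v))
      = poly (P ?b u v) e + poly (P ?b u v) (e + (u + v))"
      unfolding flip neg
      \<comment> \<open>The second instance starts at \<open>e + (u + v)\<close> and shifts by
        \<open>- (u + v)\<close>, so it evaluates at the same two points in reverse order. Both
        right-hand sides consist of the same four products of powers of \<open>e\<close>,
        \<open>e + u\<close> and \<open>e + (u + v)\<close>.\<close>
      using sum_pi_coeff_powers[where k=l and l=k and u=v and v=u and e=e]
        sum_pi_coeff_powers[where k=k and l=l and u="-u" and v="-v" and e="e + (u + v)"]
      by (simp add: poly_P ac_simps)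
  qed
  then have "poly (P (\<lambda>n i. pi_coeff l k n (n - i)) u v) e = poly (P ?b u v) e" for u v e
    by simp
  then show ?thesis
    unfolding poly_P using assms by (rule rat_homogeneous_coeffs_eqI)
qed

section \<open>Moving powers of \<open>d\<close> to the right, and the product formula\<close>

context rat_algebra
begin

text \<open>Pascal's rule, as the induction step shared by the binomial formula for
  \<open>d ^ k * z\<close> and the Leibniz rule.\<close>

lemma sum_scale_binomial_Suc:
  "(\<Sum>i\<le>Suc k. scale (of_nat (Suc k choose i)) (S i (Suc k - i)))
   = (\<Sum>i\<le>k. scale (of_nat (k choose i)) (S (Suc i) (k - i) + S i (Suc (k - i))))"
proof -
  have "(\<Sum>i\<le>Suc k. scale (of_nat (Suc k choose i)) (S i (Suc k - i)))
      = S 0 (Suc k) + (\<Sum>i\<le>k. scale (of_nat (k choose Suc i)) (S (Suc i) (k - i)))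
        + (\<Sum>i\<le>k. scale (of_nat (k choose i)) (S (Suc i) (k - i)))"
    by (subst sum.atMost_Suc_shift) (simp add: scale_left_distrib sum.distrib add_ac)
  also have "S 0 (Suc k) + (\<Sum>i\<le>k. scale (of_nat (k choose Suc i)) (S (Suc i) (k - i)))
      = (\<Sum>i\<le>Suc k. scale (of_nat (k choose i)) (S i (Suc k - i)))"
    by (subst sum.atMost_Suc_shift) simp
  also have "\<dots> = (\<Sum>i\<le>k. scale (of_nat (k choose i)) (S i (Suc (k - i))))"
    by (simp add: binomial_eq_0 Suc_diff_le)
  finally show ?thesis
    by (simp add: scale_right_distrib sum.distrib add_ac)
qed

text \<open>Left multiplication by \<open>d\<close> is \<open>commutator d\<close> plus right
  multiplication by \<open>d\<close>. These two operators commute, so the binomial theorem applies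
  to their sum.\<close>

lemma power_mult_eq_sum_commutator:
  "d ^ k * z = (\<Sum>i\<le>k. scale (of_nat (k choose i)) ((commutator d ^^ i) z * d ^ (k - i)))"
proof (induction k)
  case (Suc k)
  have "d * ((commutator d ^^ i) z * d ^ r)
      = (commutator d ^^ Suc i) z * d ^ r + (commutator d ^^ i) z * d ^ Suc r" for i r
    by (simp add: commutator_def algebra_simps)
  then show ?case
    by (simp only: power_Suc mult.assoc Suc sum_distrib_left scale_mult_right
        sum_scale_binomial_Suc[of k "\<lambda>i r. (commutator d ^^ i) z * d ^ r"])
qed simp

lemma commutator_add_right: "commutator a (b + c) = commutator a b + commutator a c"
  by (simp add: commutator_def algebra_simps)

lemma commutator_add_left: "commutator (a + b) c = commutator a c + commutator b c"
  by (simp add: commutator_def algebra_simps)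

lemma commutator_scale_right: "commutator a (scale r b) = scale r (commutator a b)"
  by (simp add: commutator_def scale_mult_left scale_mult_right scale_right_diff_distrib)

lemma commutator_scale_left: "commutator (scale r a) b = scale r (commutator a b)"
  by (simp add: commutator_def scale_mult_left scale_mult_right scale_right_diff_distrib)

lemma commutator_sum_right: "commutator a (sum f K) = (\<Sum>k\<in>K. commutator a (f k))"
  by (simp add: commutator_def sum_distrib_left sum_distrib_right sum_subtractf)

lemma commutator_sum_left: "commutator (sum f K) a = (\<Sum>k\<in>K. commutator (f k) a)"
  by (simp add: commutator_def sum_distrib_left sum_distrib_right sum_subtractf)

text \<open>The higher Leibniz rule for the derivation \<open>commutator d\<close>.\<close>

lemma commutator_funpow_mult:
  "(commutator d ^^ n) (x * y)
   = (\<Sum>i\<le>n. scale (of_nat (n choose i)) ((commutator d ^^ i) x * (commutator d ^^ (n - i)) y))"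
proof (induction n)
  case (Suc n)
  have "commutator d (a * b) = commutator d a * b + a * commutator d b" for a b
    by (simp add: commutator_def algebra_simps)
  then show ?case
    by (simp only: funpow.simps comp_apply Suc commutator_sum_right commutator_scale_right
        sum_scale_binomial_Suc[of n "\<lambda>i r. (commutator d ^^ i) x * (commutator d ^^ r) y"])
qed simp

text \<open>Moving all powers of \<open>d\<close> to the right on both sides leaves an instance of
  \<open>pi_coeff_expansion\<close>, with products of iterates of \<open>D\<close> times a power of
  \<open>d\<close> as monomials.\<close>

lemma sym_elem_mult:
  fixes d :: 'a
  defines "D \<equiv> commutator d"
  shows "sym_elem scale d x k * sym_elem scale d y l
    = (\<Sum>n\<le>k + l. \<Sum>i\<le>n. scale (pi_coeff k l n i)
        (sym_elem scale d ((D ^^ i) x * (D ^^ (n - i)) y) (k + l - n)))"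
proof -
  let ?T = "\<lambda>i j r. (D ^^ i) x * (D ^^ j) y * d ^ r"
  note pw = power_mult_eq_sum_commutator[where d=d, folded D_def]
  \<comment> \<open>For \<open>w = (D ^^ i) x * (D ^^ j) y\<close> the double sum is
    \<open>d ^ r * w\<close>: the sum over \<open>a\<close> moves \<open>d ^ r\<close> to the right,
    and the sum over \<open>q\<close> is the Leibniz rule for \<open>w\<close>.\<close>
  have sym: "?T i j r + (\<Sum>a\<le>r. \<Sum>q\<le>a. scale (of_nat (r choose a) * of_nat (a choose q))
                          (?T (i + q) (j + (a - q)) (r - a)))
      = scale 2 (sym_elem scale d ((D ^^ i) x * (D ^^ j) y) r)"
    for i j r
  proof -
    have "(D ^^ (i + q)) z = (D ^^ q) ((D ^^ i) z)" for i q z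
      by (simp add: funpow_add add.commute[of i])
    then show ?thesis
      by (simp add: sym_elem_def pw commutator_funpow_mult[where d=d, folded D_def]
          sum_distrib_right scale_sum_right scale_mult_left del: Nat.add_diff_assoc)
  qed
  have q_sum: "(\<Sum>q\<le>K. scale (c * of_nat (K choose q)) (z * (D ^^ q) y * d ^ (K + r - q)))
      = scale c (z * (d ^ K * y) * d ^ r)" for K r c z
    unfolding pw[of K y] sum_distrib_left sum_distrib_right scale_sum_right
    by (intro sum.cong refl)
      (simp add: scale_mult_left scale_mult_right mult.assoc power_add Nat.diff_add_assoc2
        del: Nat.add_diff_assoc2)
  have p_sum: "(\<Sum>p\<le>k. scale (of_nat (k choose p)) ((D ^^ p) x * (d ^ (k - p) * w))) = d ^ k * x * w" for w
    unfolding pw[of k x] sum_distrib_right by (simp add: scale_mult_left mult.assoc)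
  have 1: "(\<Sum>j\<le>k. scale (of_nat (k choose j)) (?T 0 j (k + l - j))) = x * (d ^ k * y) * d ^ l"
    using q_sum[where K=k and r=l and c=1 and z=x] by simp
  have 2: "(\<Sum>j\<le>k + l. scale (of_nat ((k + l) choose j)) (?T 0 j (k + l - j))) = x * (d ^ (k + l) * y)"
    using q_sum[where K="k + l" and r=0 and c=1 and z=x] by simp
  have 3: "(\<Sum>p\<le>k. \<Sum>q\<le>k - p. scale (of_nat (k choose p) * of_nat ((k - p) choose q))
        (?T p q (k + l - p - q))) = d ^ k * x * (y * d ^ l)"
    unfolding p_sum[symmetric]
  proof (intro sum.cong refl)
    fix p assume "p \<in> {..k}"
    then have "k + l - p - q = k - p + l - q" for q by simp
    then show "(\<Sum>q\<le>k - p. scale (of_nat (k choose p) * of_nat ((k - p) choose q)) (?T p q (k + l - p - q)))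
        = scale (of_nat (k choose p)) ((D ^^ p) x * (d ^ (k - p) * (y * d ^ l)))"
      by (simp only: q_sum) (simp only: mult.assoc)
  qed
  have 4: "(\<Sum>p\<le>k. \<Sum>q\<le>k + l - p. scale (of_nat (k choose p) * of_nat ((k + l - p) choose q))
        (?T p q (k + l - p - q))) = d ^ k * x * (d ^ l * y)"
    unfolding p_sum[symmetric]
  proof (intro sum.cong refl)
    fix p assume "p \<in> {..k}"
    then have "d ^ (k + l - p) = d ^ (k - p) * d ^ l" by (simp flip: power_add)
    then show "(\<Sum>q\<le>k + l - p. scale (of_nat (k choose p) * of_nat ((k + l - p) choose q)) (?T p q (k + l - p - q)))
        = scale (of_nat (k choose p)) ((D ^^ p) x * (d ^ (k - p) * (d ^ l * y)))"
      using q_sum[where K="k + l - p" and r=0 and c="of_nat (k choose p)" and z="(D ^^ p) x"]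
      by (simp add: mult.assoc)
  qed
  \<comment> \<open>The factor 4 clears the two halves; the four products are the sums evaluated in
    \<open>1\<close> to \<open>4\<close>, in this order.\<close>
  have "scale 4 (sym_elem scale d x k * sym_elem scale d y l)
      = x * (d ^ k * y) * d ^ l + x * (d ^ (k + l) * y) + d ^ k * x * (y * d ^ l) + d ^ k * x * (d ^ l * y)"
    by (simp add: sym_elem_def scale_mult_left scale_mult_right power_add algebra_simps)
  also have "\<dots> = scale 4 (\<Sum>n\<le>k + l. \<Sum>i\<le>n. scale (pi_coeff k l n i)
        (sym_elem scale d ((D ^^ i) x * (D ^^ (n - i)) y) (k + l - n)))"
    using pi_coeff_expansion[OF vector_space_axioms, of k l ?T]
    unfolding sym 1 2 3 4 by (simp add: scale_sum_right mult_ac)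
  finally show ?thesis by (simp add: scale_cancel_left)
qed

text \<open>By \<open>comm\<close> both orders of the product expand over the same elements, with
  coefficients that differ by the sign \<open>(-1) ^ n\<close>. The difference carries the factor
  \<open>1 - (-1) ^ n\<close>, which is 0 for even and 2 for odd \<open>n\<close>.\<close>

lemma commutator_sym_elem:
  fixes d :: 'a
  defines "D \<equiv> commutator d"
  assumes comm: "\<And>i j. (D ^^ i) x * (D ^^ j) y = (D ^^ j) y * (D ^^ i) x"
  shows "commutator (sym_elem scale d x k) (sym_elem scale d y l)
    = (\<Sum>n | 2 * n + 1 \<le> k + l. \<Sum>i = 0..2 * n + 1. scale (lambda_coeff k l n i)
        (sym_elem scale d ((D ^^ i) x * (D ^^ (2 * n + 1 - i)) y) (k + l - (2 * n + 1))))"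
proof -
  let ?S = "\<lambda>n i. sym_elem scale d ((D ^^ i) x * (D ^^ (n - i)) y) (k + l - n)"
  have "sym_elem scale d y l * sym_elem scale d x k
      = (\<Sum>n\<le>k + l. \<Sum>i\<le>n. scale (pi_coeff l k n i)
          (sym_elem scale d ((D ^^ i) y * (D ^^ (n - i)) x) (k + l - n)))"
    by (simp add: sym_elem_mult D_def add.commute)
  also have "\<dots> = (\<Sum>n\<le>k + l. \<Sum>i\<le>n. scale ((-1) ^ n * pi_coeff k l n i) (?S n i))"
  proof (rule sum.cong[OF refl])
    fix n assume "n \<in> {..k + l}"
    then show "(\<Sum>i\<le>n. scale (pi_coeff l k n i)
          (sym_elem scale d ((D ^^ i) y * (D ^^ (n - i)) x) (k + l - n)))
        = (\<Sum>i\<le>n. scale ((-1) ^ n * pi_coeff k l n i) (?S n i))"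
      by (intro sum.reindex_bij_witness[where i="\<lambda>i. n - i" and j="\<lambda>i. n - i"])
        (auto simp: comm pi_coeff_swap[symmetric])
  qed
  finally have "commutator (sym_elem scale d x k) (sym_elem scale d y l)
      = (\<Sum>n\<le>k + l. \<Sum>i\<le>n. scale ((1 - (-1) ^ n) * pi_coeff k l n i) (?S n i))"
    by (simp add: commutator_def sym_elem_mult D_def left_diff_distrib scale_left_diff_distrib sum_subtractf)
  also have "\<dots> = (\<Sum>n | n \<le> k + l \<and> odd n. \<Sum>i\<le>n. scale (2 * pi_coeff k l n i) (?S n i))"
    by (rule sum.mono_neutral_cong_right) auto
  \<comment> \<open>Odd indices are written \<open>2 * n + 1\<close>. The bound
    \<open>2 * n + 1 \<le> k + l\<close> avoids truncated subtraction and leaves the sum empty for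
    \<open>k = l = 0\<close>.\<close>
  also have "\<dots> = (\<Sum>n | 2 * n + 1 \<le> k + l. \<Sum>i = 0..2 * n + 1. scale (lambda_coeff k l n i) (?S (2 * n + 1) i))"
    by (rule sum.reindex_bij_witness[where i="\<lambda>n. 2 * n + 1" and j="\<lambda>n. n div 2"])
      (auto simp: lambda_coeff_def atMost_atLeast0 elim!: oddE)
  finally show ?thesis .
qed

section \<open>The sum of the components as a Lie algebra\<close>

text \<open>Since \<open>sym_elem\<close> is linear in its element of \<open>C\<close>, linear
  combinations within one degree collapse to a single summand. In the form of a span, closure under
  the commutator can be checked on generators.\<close>

lemma F_sum_eq_span:
  assumes "subspace C"
  shows "F_sum scale C d = span {sym_elem scale d x k | x k. x \<in> C}"
proof
  show "F_sum scale C d \<subseteq> span {sym_elem scale d x k | x k. x \<in> C}"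
  proof
    fix u assume "u \<in> F_sum scale C d"
    then obtain K f where u: "u = (\<Sum>k\<in>K. f k)" and f: "\<forall>k\<in>K. f k \<in> F_comp scale C d k"
      unfolding F_sum_def by blast
    show "u \<in> span {sym_elem scale d x k | x k. x \<in> C}"
      unfolding u
    proof (intro span_sum span_base)
      fix k assume "k \<in> K"
      with f have "f k \<in> F_comp scale C d k" by blast
      then show "f k \<in> {sym_elem scale d x k | x k. x \<in> C}"
        unfolding F_comp_def by blast
    qed
  qed
next
  have add: "u + v \<in> F_comp scale C d k" if "u \<in> F_comp scale C d k" "v \<in> F_comp scale C d k" for u v k
  proof -
    from that obtain x y where "x \<in> C" "y \<in> C" "u = sym_elem scale d x k" "v = sym_elem scale d y k"
      by (auto simp: F_comp_def)
    then show ?thesis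
      using subspace_add[OF assms, of x y]
      by (auto simp: F_comp_def sym_elem_def distrib_left distrib_right scale_right_distrib
          add_ac intro!: exI[of _ "x + y"])
  qed
  have zero: "0 \<in> F_comp scale C d k" for k
    using subspace_0[OF assms] by (auto simp: F_comp_def sym_elem_def intro!: exI[of _ 0])
  have scale: "scale r u \<in> F_comp scale C d k" if u: "u \<in> F_comp scale C d k" for r u k
  proof -
    from u obtain x where "x \<in> C" "u = sym_elem scale d x k"
      by (auto simp: F_comp_def)
    then show ?thesis
      using subspace_scale[OF assms, of x r]
      by (auto simp: F_comp_def sym_elem_def scale_mult_left scale_mult_right scale_right_distrib
          intro!: exI[of _ "scale r x"])
  qed
  have "subspace (F_sum scale C d)"
    unfolding subspace_def
  proof (intro conjI ballI allI)
    show "0 \<in> F_sum scale C d"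
      unfolding F_sum_def by (intro CollectI exI[of _ "{}"]) auto
  next
    fix u v assume "u \<in> F_sum scale C d" "v \<in> F_sum scale C d"
    then obtain K f L g where K: "finite K" "\<forall>k\<in>K. f k \<in> F_comp scale C d k" "u = (\<Sum>k\<in>K. f k)"
      and L: "finite L" "\<forall>k\<in>L. g k \<in> F_comp scale C d k" "v = (\<Sum>k\<in>L. g k)"
      unfolding F_sum_def by blast
    \<comment> \<open>Extending both families by 0 lets them share the index set
      \<open>K \<union> L\<close> with one summand per degree.\<close>
    let ?h = "\<lambda>k. (if k \<in> K then f k else 0) + (if k \<in> L then g k else 0)"
    have "u + v = (\<Sum>k\<in>K \<union> L. ?h k)"
      using K(1,3) L(1,3) by (simp add: sum.distrib sum.If_cases Int_absorb1)
    moreover have "\<forall>k\<in>K \<union> L. ?h k \<in> F_comp scale C d k"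
      using K(2) L(2) by (auto intro: add)
    ultimately show "u + v \<in> F_sum scale C d"
      using K(1) L(1) unfolding F_sum_def by blast
  next
    fix r u assume "u \<in> F_sum scale C d"
    then obtain K f where K: "finite K" "\<forall>k\<in>K. f k \<in> F_comp scale C d k" "u = (\<Sum>k\<in>K. f k)"
      unfolding F_sum_def by blast
    then have "scale r u = (\<Sum>k\<in>K. scale r (f k))" "\<forall>k\<in>K. scale r (f k) \<in> F_comp scale C d k"
      by (auto simp: scale_sum_right scale)
    with K(1) show "scale r u \<in> F_sum scale C d"
      unfolding F_sum_def by blast
  qed
  moreover have "sym_elem scale d x k \<in> F_sum scale C d" if "x \<in> C" for x k
    unfolding F_sum_def
    by (intro CollectI exI[of _ "{k}"] exI[of _ "\<lambda>_. sym_elem scale d x k"])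
      (use that in \<open>auto simp: F_comp_def\<close>)
  ultimately show "span {sym_elem scale d x k | x k. x \<in> C} \<subseteq> F_sum scale C d"
    by (intro span_minimal) auto
qed

text \<open>Bilinearity, one argument at a time: first the right one is extended to the span for a
  fixed left generator, then the left one.\<close>

lemma commutator_span_closed:
  assumes "\<And>a b. a \<in> S \<Longrightarrow> b \<in> S \<Longrightarrow> commutator a b \<in> span S"
    and "a \<in> span S" "b \<in> span S"
  shows "commutator a b \<in> span S"
proof -
  have sub1: "subspace {a. commutator a b \<in> span S}" for b
    unfolding subspace_def
    by (auto simp: commutator_add_left commutator_scale_left span_scale span_add)
      (auto simp: commutator_def span_zero)
  have sub2: "subspace {b. commutator a b \<in> span S}" for a
    unfolding subspace_def
    by (auto simp: commutator_add_right commutator_scale_right span_scale span_add)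
      (auto simp: commutator_def span_zero)
  have "span S \<subseteq> {b. commutator a b \<in> span S}" if "a \<in> S" for a
    using assms(1) that by (intro span_minimal sub2) auto
  then have "span S \<subseteq> {a. commutator a b \<in> span S}"
    using \<open>b \<in> span S\<close> by (intro span_minimal sub1) auto
  with \<open>a \<in> span S\<close> show ?thesis by auto
qed

end

theorem theorem5:
  fixes scale :: "rat \<Rightarrow> 'a::ring_1 \<Rightarrow> 'a"
    and C :: "'a set"
    and d :: 'a
    and D :: "'a \<Rightarrow> 'a"
  assumes "rat_algebra scale"
    and "commutative_subalgebra scale C"
    and "d \<in> lie_idealiser C - C"
    and "D = commutator d"
  shows "lie_algebra_on scale (F_sum scale C d) commutator \<and>
    (\<forall>x\<in>C. \<forall>y\<in>C. \<forall>k l :: nat.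
      commutator (sym_elem scale d x k) (sym_elem scale d y l) =
        (\<Sum>n | 2 * n + 1 \<le> k + l. \<Sum>i = 0..2 * n + 1.
          scale (lambda_coeff k l n i)
            (sym_elem scale d ((D ^^ i) x * (D ^^ (2 * n + 1 - i)) y) (k + l - (2 * n + 1)))))"
proof -
  interpret rat_algebra scale by fact
  have C: "subspace C" "\<And>x y. x \<in> C \<Longrightarrow> y \<in> C \<Longrightarrow> x * y \<in> C"
    "\<And>x y. x \<in> C \<Longrightarrow> y \<in> C \<Longrightarrow> x * y = y * x"
    using assms(2) by (auto simp: commutative_subalgebra_def)
  \<comment> \<open>Because \<open>d\<close> idealises \<open>C\<close>, all iterates of
    \<open>D\<close> on \<open>C\<close> stay in \<open>C\<close>. They therefore commute, as
    \<open>commutator_sym_elem\<close> requires.\<close>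
  have "D x \<in> C" if "x \<in> C" for x
    using assms(3,4) that by (auto simp: lie_idealiser_def)
  then have D: "(D ^^ i) x \<in> C" if "x \<in> C" for i x
    using that by (induction i) auto
  have formula: "commutator (sym_elem scale d x k) (sym_elem scale d y l) =
        (\<Sum>n | 2 * n + 1 \<le> k + l. \<Sum>i = 0..2 * n + 1.
          scale (lambda_coeff k l n i)
            (sym_elem scale d ((D ^^ i) x * (D ^^ (2 * n + 1 - i)) y) (k + l - (2 * n + 1))))"
    if "x \<in> C" "y \<in> C" for x y k l
    unfolding assms(4) by (intro commutator_sym_elem C(3) D[unfolded assms(4)] that)
  let ?S = "{sym_elem scale d x k | x k. x \<in> C}"
  have "commutator a b \<in> span ?S" if "a \<in> ?S" "b \<in> ?S" for a b
  proof -
    from that obtain x y k l where xy: "x \<in> C" "y \<in> C"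
      and ab: "a = sym_elem scale d x k" "b = sym_elem scale d y l"
      by auto
    show ?thesis
      \<comment> \<open>Each term of the formula is a multiple of a generator, because
        \<open>C\<close> is closed under products and under \<open>D\<close>.\<close>
      unfolding ab formula[OF xy] using C(2) D xy
      by (intro span_sum span_scale span_base) blast
  qed
  then have closed: "commutator a b \<in> F_sum scale C d"
    if "a \<in> F_sum scale C d" "b \<in> F_sum scale C d" for a b
    using that unfolding F_sum_eq_span[OF C(1)] by (rule commutator_span_closed)
  have "lie_algebra_on scale (F_sum scale C d) commutator"
  proof
    show "subspace (F_sum scale C d)"
      by (simp add: F_sum_eq_span[OF C(1)])
    show "commutator x (commutator y z) + commutator y (commutator z x)
        + commutator z (commutator x y) = 0" for x y z
      by (simp add: commutator_def algebra_simps)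
    show "commutator x x = 0" for x
      by (simp add: commutator_def)
  qed (simp_all add: closed commutator_add_left commutator_add_right commutator_scale_left commutator_scale_right)
  with formula show ?thesis by blast
qed

end
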